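(* Let $q$ be an odd prime power and $d \in \mathbb{F}_q\setminus\{0,1\}$. Then the Edwards curve $E_d$ and the Legendre curve $L_d$ are isogenous over $\mathbb{F}_q$.
   Context: The Edwards curve $E_d$ is the elliptic curve over $\mathbb{F}_q$ obtained as the desingularization of the projective closure of $x^2+y^2 = 1+dx^2y^2$; the Legendre curve $L_d$ is the elliptic curve $y^2 = x(x-1)(x-d)$ over $\mathbb{F}_q$. *)

theory Defs
  imports
    "HOL-Analysis.Cartesian_Space"
    "HOL-Library.Poly_Mapping"
    "HOL-Algebra.Algebraic_Closure_Type"
begin

text \<open>
  Classical projective algebraic geometry over a perfect field \<open>k\<close>: varieties are sets of points
  with coordinates in the algebraic closure of \<open>k\<close>, and ``over \<open>k\<close>'' refers to polynomials whose
  coefficients lie in \<open>k\<close>.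
\<close>

section \<open>Projective space\<close>

definition proj_rel :: "'a::field ^ 'n \<Rightarrow> 'a ^ 'n \<Rightarrow> bool" where
  "proj_rel v w \<longleftrightarrow> v \<noteq> 0 \<and> w \<noteq> 0 \<and> (\<exists>c. c \<noteq> 0 \<and> w = c *s v)"

lemma part_equivp_proj_rel: "part_equivp (proj_rel :: 'a::field ^ 'n \<Rightarrow> _)"
proof (rule part_equivpI)
  have "(1 :: 'a ^ 'n) \<noteq> 0" "(1 :: 'a ^ 'n) = 1 *s 1"
    by (simp_all add: vec_eq_iff)
  then show "\<exists>x :: 'a ^ 'n. proj_rel x x"
    unfolding proj_rel_def using one_neq_zero by blast
  show "symp (proj_rel :: 'a ^ 'n \<Rightarrow> _)"
  proof (rule sympI)
    fix v w :: "'a ^ 'n"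
    assume "proj_rel v w"
    then obtain c where c: "v \<noteq> 0" "w \<noteq> 0" "c \<noteq> 0" "w = c *s v"
      unfolding proj_rel_def by blast
    then have "v = inverse c *s w"
      by (simp add: vec_eq_iff)
    with c show "proj_rel w v"
      unfolding proj_rel_def by (meson nonzero_imp_inverse_nonzero)
  qed
  show "transp (proj_rel :: 'a ^ 'n \<Rightarrow> _)"
  proof (rule transpI)
    fix u v w :: "'a ^ 'n"
    assume "proj_rel u v" "proj_rel v w"
    then obtain c e where "u \<noteq> 0" "w \<noteq> 0" "c \<noteq> 0" "e \<noteq> 0" "v = c *s u" "w = e *s v"
      unfolding proj_rel_def by blast
    then have "u \<noteq> 0" "w \<noteq> 0" "e * c \<noteq> 0" "w = (e * c) *s u"
      by (simp_all add: vec_eq_iff)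
    then show "proj_rel u w"
      unfolding proj_rel_def by blast
  qed
qed

text \<open>
  The points of the projective space of dimension \<open>CARD('n) - 1\<close>.  For \<open>v \<noteq> 0\<close>, \<open>abs_proj v\<close> is the
  point with homogeneous coordinates \<open>v\<close>, and \<open>rep_proj P\<close> is some choice of homogeneous
  coordinates of \<open>P\<close>.
\<close>

quotient_type (overloaded) ('a, 'n) proj = "'a::field ^ 'n::finite" / partial: proj_rel
  by (rule part_equivp_proj_rel)


section \<open>Homogeneous polynomials and projective varieties\<close>

type_synonym ('n, 'a) mpoly = "('n \<Rightarrow>\<^sub>0 nat) \<Rightarrow>\<^sub>0 'a"

definition mpoly_eval :: "('n::finite, 'a::field) mpoly \<Rightarrow> 'a ^ 'n \<Rightarrow> 'a" where
  "mpoly_eval f v = (\<Sum>m\<in>Poly_Mapping.keys f.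
     Poly_Mapping.lookup f m * (\<Prod>i\<in>UNIV. (v $ i) ^ Poly_Mapping.lookup m i))"

definition homogeneous :: "nat \<Rightarrow> ('n::finite, 'a::field) mpoly \<Rightarrow> bool" where
  "homogeneous n f \<longleftrightarrow>
     (\<forall>m\<in>Poly_Mapping.keys f. (\<Sum>i\<in>UNIV. Poly_Mapping.lookup m i) = n)"

definition over_base :: "('n, 'k::field alg_closure) mpoly \<Rightarrow> bool" where
  "over_base f \<longleftrightarrow> (\<forall>m. Poly_Mapping.lookup f m \<in> range to_ac)"

text \<open>Only used for homogeneous \<open>f\<close>, where it does not depend on the choice of coordinates.\<close>

definition vanishes_at :: "('n::finite, 'a::field) mpoly \<Rightarrow> ('a, 'n) proj \<Rightarrow> bool" where
  "vanishes_at f P \<longleftrightarrow> mpoly_eval f (rep_proj P) = 0"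

definition zero_locus :: "('n::finite, 'a::field) mpoly set \<Rightarrow> ('a, 'n) proj set" where
  "zero_locus S = {P. \<forall>f\<in>S. vanishes_at f P}"

definition zariski_closed :: "('a::field, 'n::finite) proj set \<Rightarrow> bool" where
  "zariski_closed V \<longleftrightarrow> (\<exists>S. (\<forall>f\<in>S. \<exists>n. homogeneous n f) \<and> V = zero_locus S)"

text \<open>For a perfect field \<open>k\<close> this agrees with the vanishing ideal being generated over \<open>k\<close>.\<close>

definition defined_over_base :: "('k::field alg_closure, 'n::finite) proj set \<Rightarrow> bool" where
  "defined_over_base V \<longleftrightarrow>
     (\<exists>S. (\<forall>f\<in>S. over_base f \<and> (\<exists>n. homogeneous n f)) \<and> V = zero_locus S)"

definition zariski_closure :: "('a::field, 'n::finite) proj set \<Rightarrow> ('a, 'n) proj set" where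
  "zariski_closure A = \<Inter>{V. zariski_closed V \<and> A \<subseteq> V}"

definition projective_variety :: "('a::field, 'n::finite) proj set \<Rightarrow> bool" where
  "projective_variety V \<longleftrightarrow> zariski_closed V \<and> V \<noteq> {} \<and>
     (\<forall>A B. zariski_closed A \<longrightarrow> zariski_closed B \<longrightarrow> V \<subseteq> A \<union> B \<longrightarrow> V \<subseteq> A \<or> V \<subseteq> B)"

text \<open>Dimension one: the maximal chains of irreducible closed subsets are \<open>{P} \<subset> V\<close>.\<close>

definition projective_curve :: "('a::field, 'n::finite) proj set \<Rightarrow> bool" where
  "projective_curve V \<longleftrightarrow> projective_variety V \<and> \<not> is_singleton V \<and>
     (\<forall>W. projective_variety W \<longrightarrow> W \<subset> V \<longrightarrow> is_singleton W)"


section \<open>Local rings and nonsingularity\<close>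

text \<open>
  Elements of the local ring of \<open>V\<close> at \<open>P\<close> are represented by fractions \<open>f / g\<close>, written \<open>(f, g)\<close>, of
  homogeneous polynomials of equal degree with \<open>g\<close> not vanishing at \<open>P\<close>.  Two fractions represent
  the same rational function on \<open>V\<close> iff the cross-multiplied difference vanishes on \<open>V\<close>.
\<close>

definition local_fractions ::
    "('a::field, 'n::finite) proj \<Rightarrow> (('n, 'a) mpoly \<times> ('n, 'a) mpoly) set" where
  "local_fractions P =
     {(f, g). (\<exists>n. homogeneous n f \<and> homogeneous n g) \<and> \<not> vanishes_at g P}"

definition maximal_fractions ::
    "('a::field, 'n::finite) proj \<Rightarrow> (('n, 'a) mpoly \<times> ('n, 'a) mpoly) set" where
  "maximal_fractions P = {(f, g) \<in> local_fractions P. vanishes_at f P}"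

definition fraction_eq_on :: "('a::field, 'n::finite) proj set \<Rightarrow>
    ('n, 'a) mpoly \<times> ('n, 'a) mpoly \<Rightarrow> ('n, 'a) mpoly \<times> ('n, 'a) mpoly \<Rightarrow> bool" where
  "fraction_eq_on V r s \<longleftrightarrow> (\<forall>P\<in>V. vanishes_at (fst r * snd s - fst s * snd r) P)"

text \<open>
  A point of a curve is nonsingular iff its local ring is a regular local ring of dimension one,
  i.e. its maximal ideal is generated by a single element.
\<close>

definition nonsingular_at :: "('a::field, 'n::finite) proj set \<Rightarrow> ('a, 'n) proj \<Rightarrow> bool" where
  "nonsingular_at V P \<longleftrightarrow> (\<exists>t\<in>maximal_fractions P. \<forall>s\<in>maximal_fractions P.
     \<exists>r\<in>local_fractions P. fraction_eq_on V s (fst r * fst t, snd r * snd t))"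

definition nonsingular_projective_curve :: "('a::field, 'n::finite) proj set \<Rightarrow> bool" where
  "nonsingular_projective_curve V \<longleftrightarrow> projective_curve V \<and> (\<forall>P\<in>V. nonsingular_at V P)"


section \<open>Rational maps, morphisms and desingularization\<close>

text \<open>
  A rational map to the projective space with coordinates indexed by \<open>'m\<close> is given by a tuple
  \<open>F\<close> of homogeneous polynomials of equal degree; \<open>F\<close> determines its value at \<open>P\<close> if not all of
  its entries vanish at \<open>P\<close>.
\<close>

definition homogeneous_tuple :: "('m \<Rightarrow> ('n::finite, 'a::field) mpoly) \<Rightarrow> bool" where
  "homogeneous_tuple F \<longleftrightarrow> (\<exists>n. \<forall>i. homogeneous n (F i))"

definition nonzero_at ::
    "('m \<Rightarrow> ('n::finite, 'a::field) mpoly) \<Rightarrow> ('a, 'n) proj \<Rightarrow> bool" where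
  "nonzero_at F P \<longleftrightarrow> (\<exists>i. \<not> vanishes_at (F i) P)"

definition tuple_value ::
    "('m::finite \<Rightarrow> ('n::finite, 'a::field) mpoly) \<Rightarrow> ('a, 'n) proj \<Rightarrow> ('a, 'm) proj" where
  "tuple_value F P = abs_proj (\<chi> i. mpoly_eval (F i) (rep_proj P))"

definition represents_on :: "('a::field, 'n::finite) proj set \<Rightarrow>
    ('m::finite \<Rightarrow> ('n, 'a) mpoly) \<Rightarrow> (('a, 'n) proj \<Rightarrow> ('a, 'm) proj) \<Rightarrow> bool" where
  "represents_on V F \<phi> \<longleftrightarrow> homogeneous_tuple F \<and>
     (\<forall>P\<in>V. nonzero_at F P \<longrightarrow> \<phi> P = tuple_value F P)"

definition morphism_on :: "('a::field, 'n::finite) proj set \<Rightarrow> ('a, 'm::finite) proj set \<Rightarrow>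
    (('a, 'n) proj \<Rightarrow> ('a, 'm) proj) \<Rightarrow> bool" where
  "morphism_on V W \<phi> \<longleftrightarrow> \<phi> ` V \<subseteq> W \<and>
     (\<forall>P\<in>V. \<exists>F. represents_on V F \<phi> \<and> nonzero_at F P)"

text \<open>
  A morphism is defined over \<open>k\<close> iff the underlying rational map is given by a tuple of
  polynomials over \<open>k\<close>.
\<close>

definition morphism_over_base :: "('k::field alg_closure, 'n::finite) proj set \<Rightarrow>
    ('k alg_closure, 'm::finite) proj set \<Rightarrow>
    (('k alg_closure, 'n) proj \<Rightarrow> ('k alg_closure, 'm) proj) \<Rightarrow> bool" where
  "morphism_over_base V W \<phi> \<longleftrightarrow> morphism_on V W \<phi> \<and>
     (\<exists>F. (\<forall>i. over_base (F i)) \<and> represents_on V F \<phi> \<and> (\<exists>P\<in>V. nonzero_at F P))"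

text \<open>A morphism over \<open>k\<close> with a rational inverse, given by \<open>G\<close>, over \<open>k\<close>.\<close>

definition birational_morphism_over_base :: "('k::field alg_closure, 'n::finite) proj set \<Rightarrow>
    ('k alg_closure, 'm::finite) proj set \<Rightarrow>
    (('k alg_closure, 'n) proj \<Rightarrow> ('k alg_closure, 'm) proj) \<Rightarrow> bool" where
  "birational_morphism_over_base V W \<phi> \<longleftrightarrow> morphism_over_base V W \<phi> \<and>
     (\<exists>G. (\<forall>i. over_base (G i)) \<and> homogeneous_tuple G \<and> (\<exists>Q\<in>W. nonzero_at G Q) \<and>
       (\<forall>Q\<in>W. nonzero_at G Q \<longrightarrow> tuple_value G Q \<in> V \<and> \<phi> (tuple_value G Q) = Q) \<and>
       (\<forall>P\<in>V. nonzero_at G (\<phi> P) \<longrightarrow> tuple_value G (\<phi> P) = P))"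

definition desingularization :: "('k::field alg_closure, 'n::finite) proj set \<Rightarrow>
    ('k alg_closure, 'm::finite) proj set \<Rightarrow>
    (('k alg_closure, 'n) proj \<Rightarrow> ('k alg_closure, 'm) proj) \<Rightarrow> bool" where
  "desingularization C W \<pi> \<longleftrightarrow> nonsingular_projective_curve C \<and> defined_over_base C \<and>
     birational_morphism_over_base C W \<pi>"


section \<open>Isogenies\<close>

text \<open>
  Elliptic curves are given as pairs of a curve and its base point.  An isogeny is a morphism that
  respects the base points; two curves are isogenous if there is a nonconstant isogeny from the
  first to the second.
\<close>

definition isogeny_over_base ::
    "('k::field alg_closure, 'n::finite) proj set \<times> ('k alg_closure, 'n) proj \<Rightarrow>
     ('k alg_closure, 'm::finite) proj set \<times> ('k alg_closure, 'm) proj \<Rightarrow>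
     (('k alg_closure, 'n) proj \<Rightarrow> ('k alg_closure, 'm) proj) \<Rightarrow> bool" where
  "isogeny_over_base E E' \<phi> \<longleftrightarrow>
     morphism_over_base (fst E) (fst E') \<phi> \<and> \<phi> (snd E) = snd E'"

definition isogenous_over_base ::
    "('k::field alg_closure, 'n::finite) proj set \<times> ('k alg_closure, 'n) proj \<Rightarrow>
     ('k alg_closure, 'm::finite) proj set \<times> ('k alg_closure, 'm) proj \<Rightarrow> bool" where
  "isogenous_over_base E E' \<longleftrightarrow>
     (\<exists>\<phi>. isogeny_over_base E E' \<phi> \<and> \<not> (\<exists>Q. \<forall>P\<in>fst E. \<phi> P = Q))"


section \<open>The Edwards and Legendre curves\<close>

definition edwards_affine ::
    "'k::field \<Rightarrow> ('k alg_closure \<times> 'k alg_closure) set" where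
  "edwards_affine d = {(x, y). x\<^sup>2 + y\<^sup>2 = 1 + to_ac d * x\<^sup>2 * y\<^sup>2}"

definition edwards_projective :: "'k::field \<Rightarrow> ('k alg_closure, 3) proj set" where
  "edwards_projective d =
     zariski_closure ((\<lambda>(x, y). abs_proj (vector [x, y, 1])) ` edwards_affine d)"

text \<open>
  A desingularization is determined up to unique isomorphism only, hence a predicate.  The base
  point is the point over the neutral element \<open>(0, 1)\<close> of the Edwards addition law; it is unique,
  and hence defined over \<open>k\<close>, because \<open>(0, 1)\<close> is a nonsingular point of the plane model.
\<close>

definition is_edwards_curve :: "'k::field \<Rightarrow>
    ('k alg_closure, 'n::finite) proj set \<times> ('k alg_closure, 'n) proj \<Rightarrow> bool" where
  "is_edwards_curve d E \<longleftrightarrow> (\<exists>\<pi>. desingularization (fst E) (edwards_projective d) \<pi> \<and>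
     snd E \<in> fst E \<and> \<pi> (snd E) = abs_proj (vector [0, 1, 1]))"

text \<open>The usual projective curve of a Weierstrass equation, with the point at infinity.\<close>

definition legendre_curve ::
    "'k::field \<Rightarrow> ('k alg_closure, 3) proj set \<times> ('k alg_closure, 3) proj" where
  "legendre_curve d =
     ({abs_proj (vector [x, y, z]) | x y z.
         (x, y, z) \<noteq> (0, 0, 0) \<and> y\<^sup>2 * z = x * (x - z) * (x - to_ac d * z)},
      abs_proj (vector [0, 1, 0]))"

end

theory Submission
  imports Defs
begin

text \<open>
  On the Edwards curve \<open>(x, y) \<mapsto> (1/x\<^sup>2, y (1 - d x\<^sup>2) / x\<^sup>3)\<close> is a rational map to the Legendre
  curve that sends \<open>(0, 1)\<close> to the point at infinity.  In homogeneous coordinates it is given by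
  \<open>(x z\<^sup>2 : y (z\<^sup>2 - d x\<^sup>2) : x\<^sup>3)\<close>, and, with \<open>D = x\<^sup>2 + y\<^sup>2 - z\<^sup>2\<close>, also by
  \<open>(d y\<^sup>2 D : d x y (d y\<^sup>2 - D) : D\<^sup>2)\<close>, because the equation of the curve reads \<open>z\<^sup>2 D = d x\<^sup>2 y\<^sup>2\<close>.
  The two triples have no common zero on the singular plane model, so the map is a morphism already
  there, and it can be composed with the desingularization.  Its fibre over the point at infinity
  is finite, whereas a birational morphism from a curve has no finite image.
\<close>

section \<open>Polynomial arithmetic and evaluation\<close>

abbreviation mconst :: "'a \<Rightarrow> ('n, 'a::field) mpoly" where
  "mconst c \<equiv> Poly_Mapping.single 0 c"

definition mvar :: "'n \<Rightarrow> ('n, 'a::field) mpoly" where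
  "mvar i = Poly_Mapping.single (Poly_Mapping.single i 1) 1"

definition mono_eval :: "('n::finite \<Rightarrow>\<^sub>0 nat) \<Rightarrow> 'a::field ^ 'n \<Rightarrow> 'a" where
  "mono_eval m v = (\<Prod>i\<in>UNIV. (v $ i) ^ Poly_Mapping.lookup m i)"

lemma mono_eval_add: "mono_eval (k + l) v = mono_eval k v * mono_eval l v"
  by (simp add: mono_eval_def lookup_add power_add prod.distrib)

lemma keys_uminus: "Poly_Mapping.keys (- f) = Poly_Mapping.keys f"
  for f :: "('n, 'a::field) mpoly"
  by (auto simp: in_keys_iff)

text \<open>Monomials outside the support contribute zero. A common index set for several
  polynomials makes additivity a termwise matter, even when terms cancel in the sum.\<close>

lemma mpoly_eval_superset:
  assumes "finite A" "Poly_Mapping.keys f \<subseteq> A"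
  shows "mpoly_eval f v = (\<Sum>m\<in>A. Poly_Mapping.lookup f m * mono_eval m v)"
  unfolding mpoly_eval_def mono_eval_def
  by (rule sum.mono_neutral_left) (use assms in \<open>auto simp: in_keys_iff\<close>)

section \<open>Evaluation as a ring homomorphism\<close>

lemma mpoly_eval_add [simp]: "mpoly_eval (f + g) v = mpoly_eval f v + mpoly_eval g v"
proof -
  let ?A = "Poly_Mapping.keys f \<union> Poly_Mapping.keys g"
  have "Poly_Mapping.keys (f + g) \<subseteq> ?A"
    by (rule Poly_Mapping.keys_add)
  then show ?thesis
    by (simp add: mpoly_eval_superset[of ?A] lookup_add algebra_simps sum.distrib)
qed

lemma mpoly_eval_uminus [simp]: "mpoly_eval (- f) v = - mpoly_eval f v"
  using mpoly_eval_superset[of "Poly_Mapping.keys f" "- f" v]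
    mpoly_eval_superset[of "Poly_Mapping.keys f" f v]
  by (simp add: keys_uminus sum_negf)

lemma mpoly_eval_diff [simp]: "mpoly_eval (f - g) v = mpoly_eval f v - mpoly_eval g v"
  using mpoly_eval_add[of f "- g" v] by simp

lemma mpoly_eval_0 [simp]: "mpoly_eval 0 v = 0"
  by (simp add: mpoly_eval_def)

lemma mpoly_eval_single: "mpoly_eval (Poly_Mapping.single m c) v = c * mono_eval m v"
  by (subst mpoly_eval_superset[of "{m}"]) auto

lemma mpoly_eval_mconst [simp]: "mpoly_eval (mconst c) v = c"
  by (simp add: mpoly_eval_single mono_eval_def)

lemma mpoly_eval_1 [simp]: "mpoly_eval 1 v = 1"
  using mpoly_eval_mconst[of 1 v] by simp

lemma mpoly_eval_mvar [simp]: "mpoly_eval (mvar i) v = v $ i"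
proof -
  have "(\<Prod>j\<in>UNIV. (v $ j) ^ Poly_Mapping.lookup (Poly_Mapping.single i 1) j) =
      (\<Prod>j\<in>UNIV. if j = i then v $ j else 1)"
    by (rule prod.cong) (auto simp: lookup_single when_def)
  then show ?thesis
    by (simp add: mvar_def mpoly_eval_single mono_eval_def)
qed

lemma mpoly_eval_sum [simp]: "mpoly_eval (\<Sum>x\<in>A. f x) v = (\<Sum>x\<in>A. mpoly_eval (f x) v)"
  by (induction A rule: infinite_finite_induct) auto

lemma poly_mapping_sum_monomials:
  "(\<Sum>m\<in>Poly_Mapping.keys f. Poly_Mapping.single m (Poly_Mapping.lookup f m)) = f"
  for f :: "('n, 'a::field) mpoly"
  by (rule poly_mapping_eqI)
    (simp add: lookup_sum lookup_single when_def sum.delta in_keys_iff)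

text \<open>Replaces the convolution product by a finite double sum of monomials, on which
  evaluation and membership of the coefficients in the base field can be checked termwise.\<close>

lemma mpoly_mult_expand:
  "f * g = (\<Sum>k\<in>Poly_Mapping.keys f. \<Sum>l\<in>Poly_Mapping.keys g.
     Poly_Mapping.single (k + l) (Poly_Mapping.lookup f k * Poly_Mapping.lookup g l))"
  for f g :: "('n, 'a::field) mpoly"
proof -
  have "f * g = (\<Sum>k\<in>Poly_Mapping.keys f. Poly_Mapping.single k (Poly_Mapping.lookup f k)) *
      (\<Sum>l\<in>Poly_Mapping.keys g. Poly_Mapping.single l (Poly_Mapping.lookup g l))"
    by (simp add: poly_mapping_sum_monomials)
  then show ?thesis
    by (simp add: sum_product mult_single)
qed

lemma mpoly_eval_mult [simp]: "mpoly_eval (f * g) v = mpoly_eval f v * mpoly_eval g v"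
proof -
  have "mpoly_eval (f * g) v = (\<Sum>k\<in>Poly_Mapping.keys f. \<Sum>l\<in>Poly_Mapping.keys g.
      (Poly_Mapping.lookup f k * mono_eval k v) * (Poly_Mapping.lookup g l * mono_eval l v))"
    by (simp add: mpoly_mult_expand mpoly_eval_single mono_eval_add mult_ac)
  also have "\<dots> = mpoly_eval f v * mpoly_eval g v"
    unfolding mpoly_eval_superset[OF finite_keys order.refl] sum_product ..
  finally show ?thesis .
qed

lemma mpoly_eval_power [simp]: "mpoly_eval (f ^ n) v = mpoly_eval f v ^ n"
  by (induction n) auto

lemma mpoly_eval_prod [simp]: "mpoly_eval (\<Prod>x\<in>A. f x) v = (\<Prod>x\<in>A. mpoly_eval (f x) v)"
  by (induction A rule: infinite_finite_induct) auto

text \<open>Substitution is the algebraic counterpart of composing rational maps given by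
  tuples.\<close>

definition mpoly_subst ::
    "('n::finite, 'a::field) mpoly \<Rightarrow> ('n \<Rightarrow> ('m::finite, 'a) mpoly) \<Rightarrow> ('m, 'a) mpoly" where
  "mpoly_subst f H = (\<Sum>m\<in>Poly_Mapping.keys f.
     mconst (Poly_Mapping.lookup f m) * (\<Prod>i\<in>UNIV. H i ^ Poly_Mapping.lookup m i))"

lemma mpoly_eval_subst [simp]:
  "mpoly_eval (mpoly_subst f H) v = mpoly_eval f (\<chi> i. mpoly_eval (H i) v)"
  by (simp add: mpoly_subst_def mpoly_eval_def[of f])


section \<open>Homogeneous polynomials and polynomials over the base field\<close>

lemma homogeneous_0: "homogeneous n 0"
  by (simp add: homogeneous_def)

lemma homogeneous_add: "homogeneous n f \<Longrightarrow> homogeneous n g \<Longrightarrow> homogeneous n (f + g)"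
  unfolding homogeneous_def using Poly_Mapping.keys_add[of f g] by blast

lemma homogeneous_uminus: "homogeneous n f \<Longrightarrow> homogeneous n (- f)"
  by (simp add: homogeneous_def keys_uminus)

lemma homogeneous_diff: "homogeneous n f \<Longrightarrow> homogeneous n g \<Longrightarrow> homogeneous n (f - g)"
  using homogeneous_add[OF _ homogeneous_uminus, of n f g] by simp

lemma homogeneous_sum: "(\<And>x. x \<in> A \<Longrightarrow> homogeneous n (f x)) \<Longrightarrow> homogeneous n (\<Sum>x\<in>A. f x)"
  by (induction A rule: infinite_finite_induct) (auto simp: homogeneous_0 homogeneous_add)

lemma homogeneous_mconst: "homogeneous 0 (mconst c)"
  by (simp add: homogeneous_def)

lemma homogeneous_1: "homogeneous 0 1"
  using homogeneous_mconst[of 1] by simp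

lemma homogeneous_mvar: "homogeneous 1 (mvar i)"
  by (simp add: homogeneous_def mvar_def lookup_single when_def)

lemma homogeneous_mult:
  "homogeneous a f \<Longrightarrow> homogeneous b g \<Longrightarrow> n = a + b \<Longrightarrow> homogeneous n (f * g)"
  unfolding homogeneous_def using keys_mult[of f g]
  by (fastforce simp: lookup_add sum.distrib)

lemma homogeneous_power: "homogeneous a f \<Longrightarrow> n = k * a \<Longrightarrow> homogeneous n (f ^ k)"
proof (induction k arbitrary: n)
  case (Suc k)
  from homogeneous_mult[OF \<open>homogeneous a f\<close> Suc.IH[OF _ refl]] Suc.prems show ?case
    by simp
qed (simp add: homogeneous_1)

lemma homogeneous_prod:
  "(\<And>x. x \<in> A \<Longrightarrow> homogeneous (e x) (f x)) \<Longrightarrow> homogeneous (\<Sum>x\<in>A. e x) (\<Prod>x\<in>A. f x)"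
  by (induction A rule: infinite_finite_induct) (auto simp: homogeneous_1 intro: homogeneous_mult)

lemma homogeneous_subst:
  assumes "homogeneous n f" "\<And>i. homogeneous e (H i)"
  shows "homogeneous (n * e) (mpoly_subst f H)"
  unfolding mpoly_subst_def
proof (intro homogeneous_sum homogeneous_mult[OF homogeneous_mconst homogeneous_prod])
  fix m i
  show "homogeneous (Poly_Mapping.lookup m i * e) (H i ^ Poly_Mapping.lookup m i)"
    using assms(2) by (rule homogeneous_power) simp
next
  fix m assume "m \<in> Poly_Mapping.keys f"
  with assms(1) show "n * e = 0 + (\<Sum>i\<in>UNIV. Poly_Mapping.lookup m i * e)"
    by (simp add: homogeneous_def flip: sum_distrib_right)
qed

text \<open>Each monomial of degree \<open>n\<close> picks up the factor \<open>c ^ n\<close>. The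
  case \<open>c = 0\<close> is included on purpose: with \<open>0 ^ 0 = 1\<close> it shows that a
  form not vanishing at the origin is constant.\<close>

lemma homogeneous_eval_scale:
  assumes "homogeneous n f"
  shows "mpoly_eval f (c *s v) = c ^ n * mpoly_eval f v"
  unfolding mpoly_eval_def sum_distrib_left
proof (rule sum.cong)
  fix m assume "m \<in> Poly_Mapping.keys f"
  with assms have "c ^ n = (\<Prod>i\<in>UNIV. c ^ Poly_Mapping.lookup m i)"
    by (simp add: homogeneous_def flip: power_sum)
  then show "Poly_Mapping.lookup f m * (\<Prod>i\<in>UNIV. (c *s v) $ i ^ Poly_Mapping.lookup m i) =
      c ^ n * (Poly_Mapping.lookup f m * (\<Prod>i\<in>UNIV. v $ i ^ Poly_Mapping.lookup m i))"
    by (simp add: power_mult_distrib prod.distrib)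
qed simp

section \<open>Coefficients in the base field\<close>

lemma over_base_0: "over_base 0"
  using rangeI[of to_ac 0] by (simp add: over_base_def)

lemma over_base_add: "over_base f \<Longrightarrow> over_base g \<Longrightarrow> over_base (f + g)"
  unfolding over_base_def lookup_add image_iff by (metis UNIV_I to_ac_add)

lemma over_base_diff: "over_base f \<Longrightarrow> over_base g \<Longrightarrow> over_base (f - g)"
  unfolding over_base_def lookup_minus image_iff by (metis UNIV_I to_ac_diff)

lemma over_base_single: "c \<in> range to_ac \<Longrightarrow> over_base (Poly_Mapping.single m c)"
  using over_base_0 by (auto simp: over_base_def lookup_single when_def)

lemma over_base_1: "over_base 1"
  using over_base_single[of 1 0] rangeI[of to_ac 1] by simp

lemma over_base_mvar: "over_base (mvar i)"
  using over_base_single[of 1] rangeI[of to_ac 1] by (simp add: mvar_def)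

lemma over_base_sum: "(\<And>x. x \<in> A \<Longrightarrow> over_base (f x)) \<Longrightarrow> over_base (\<Sum>x\<in>A. f x)"
  by (induction A rule: infinite_finite_induct) (auto simp: over_base_0 over_base_add)

lemma over_base_mult:
  assumes "over_base f" "over_base g"
  shows "over_base (f * g)"
  unfolding mpoly_mult_expand
proof (intro over_base_sum over_base_single)
  fix k l
  from assms show "Poly_Mapping.lookup f k * Poly_Mapping.lookup g l \<in> range to_ac"
    unfolding over_base_def image_iff by (metis UNIV_I to_ac_mult)
qed

lemma over_base_power: "over_base f \<Longrightarrow> over_base (f ^ n)"
  by (induction n) (auto simp: over_base_1 over_base_mult)

lemma over_base_prod: "(\<And>x. x \<in> A \<Longrightarrow> over_base (f x)) \<Longrightarrow> over_base (\<Prod>x\<in>A. f x)"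
  by (induction A rule: infinite_finite_induct) (auto simp: over_base_1 over_base_mult)

lemma over_base_subst: "over_base f \<Longrightarrow> (\<And>i. over_base (H i)) \<Longrightarrow> over_base (mpoly_subst f H)"
  unfolding mpoly_subst_def
  by (intro over_base_sum over_base_mult over_base_single over_base_prod over_base_power)
    (auto simp: over_base_def)


section \<open>Points and closed sets\<close>

lemma abs_proj_eq_iff:
  "v \<noteq> 0 \<Longrightarrow> w \<noteq> 0 \<Longrightarrow> abs_proj v = abs_proj w \<longleftrightarrow> (\<exists>c. c \<noteq> 0 \<and> w = c *s v)"
  using Quotient3_rel[OF Quotient3_proj, of v w] unfolding proj_rel_def
  by (metis vector_smult_lid zero_neq_one)

lemma rep_proj_nonzero: "rep_proj P \<noteq> 0"
  using Quotient3_rep_reflp[OF Quotient3_proj, of P] by (simp add: proj_rel_def)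

lemma abs_rep_proj: "abs_proj (rep_proj P) = P"
  by (rule Quotient3_abs_rep[OF Quotient3_proj])

lemma rep_abs_projE:
  assumes "v \<noteq> 0"
  obtains c where "c \<noteq> 0" "rep_proj (abs_proj v) = c *s v"
  using assms abs_proj_eq_iff[OF assms rep_proj_nonzero] abs_rep_proj by metis

section \<open>Independence of the choice of homogeneous coordinates\<close>

lemma vanishes_at_abs_proj:
  assumes "homogeneous n f" "v \<noteq> 0"
  shows "vanishes_at f (abs_proj v) \<longleftrightarrow> mpoly_eval f v = 0"
proof -
  obtain c where "c \<noteq> 0" "rep_proj (abs_proj v) = c *s v"
    using rep_abs_projE[OF assms(2)] .
  then show ?thesis
    by (simp add: vanishes_at_def homogeneous_eval_scale[OF assms(1)])
qed

lemma nonzero_at_abs_proj: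
  assumes "homogeneous_tuple F" "v \<noteq> 0"
  shows "nonzero_at F (abs_proj v) \<longleftrightarrow> (\<chi> i. mpoly_eval (F i) v) \<noteq> 0"
  using assms vanishes_at_abs_proj
  by (fastforce simp: nonzero_at_def homogeneous_tuple_def vec_eq_iff)

text \<open>Other coordinates multiply all entries by the same factor \<open>c ^ n\<close>, because
  the entries share one degree. Nonvanishing matters, since \<open>abs_proj\<close> identifies
  points only through nonzero vectors.\<close>

lemma tuple_value_abs_proj:
  assumes "homogeneous_tuple F" "v \<noteq> 0" "nonzero_at F (abs_proj v)"
  shows "tuple_value F (abs_proj v) = abs_proj (\<chi> i. mpoly_eval (F i) v)"
proof -
  obtain n where n: "\<And>i. homogeneous n (F i)"
    using assms(1) by (auto simp: homogeneous_tuple_def)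
  obtain c where c: "c \<noteq> 0" "rep_proj (abs_proj v) = c *s v"
    using rep_abs_projE[OF assms(2)] .
  let ?w = "\<chi> i. mpoly_eval (F i) v"
  have w: "?w \<noteq> 0"
    using assms nonzero_at_abs_proj by blast
  have "(\<chi> i. mpoly_eval (F i) (c *s v)) = c ^ n *s ?w"
    by (simp add: homogeneous_eval_scale[OF n] vec_eq_iff)
  moreover have "abs_proj ?w = abs_proj (c ^ n *s ?w)"
  proof -
    have "c ^ n \<noteq> 0" "c ^ n *s ?w \<noteq> 0"
      using w c(1) by (auto simp: vec_eq_iff)
    then show ?thesis
      using abs_proj_eq_iff[OF w] by blast
  qed
  ultimately show ?thesis
    by (simp add: tuple_value_def c(2))
qed

text \<open>Vanishing of all 2 x 2 minors means proportionality. In this form equality of points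
  reduces to polynomial identities.\<close>

lemma abs_proj_eqI:
  fixes v w :: "'a::field ^ 'n::finite"
  assumes "v \<noteq> 0" "w \<noteq> 0" "\<And>i j. v $ i * w $ j = v $ j * w $ i"
  shows "abs_proj v = abs_proj w"
proof -
  obtain i where i: "v $ i \<noteq> 0"
    using assms(1) by (auto simp: vec_eq_iff)
  have w: "w = (w $ i / v $ i) *s v"
    using assms(3)[of i] i by (simp add: vec_eq_iff field_simps)
  moreover have "w $ i / v $ i \<noteq> 0"
    using w assms(2) by auto
  ultimately show ?thesis
    using abs_proj_eq_iff[OF assms(1,2)] by blast
qed

text \<open>A point is cut out by linear forms: the 2 x 2 minors of its coordinates against the
  variables.\<close>

lemma zariski_closed_singleton: "zariski_closed {P}"
proof -
  let ?v = "rep_proj P"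
  let ?S = "{mconst (?v $ i) * mvar j - mconst (?v $ j) * mvar i | i j. True}"
  have "Q = P" if "\<And>i j. ?v $ i * rep_proj Q $ j = ?v $ j * rep_proj Q $ i" for Q
    using abs_proj_eqI[OF rep_proj_nonzero rep_proj_nonzero that] by (simp add: abs_rep_proj)
  then have "{P} = zero_locus ?S"
    by (fastforce simp: zero_locus_def vanishes_at_def)
  moreover have "\<exists>n. homogeneous n f" if "f \<in> ?S" for f
    using that by (auto intro!: exI[of _ 1] homogeneous_diff
        homogeneous_mult[OF homogeneous_mconst homogeneous_mvar])
  ultimately show ?thesis
    unfolding zariski_closed_def by blast
qed

text \<open>The equations are products of one equation from each side. At a point outside both sets
  some equation of each side is nonzero, and so is their product.\<close>

lemma zariski_closed_Un:
  assumes "zariski_closed A" "zariski_closed B"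
  shows "zariski_closed (A \<union> B)"
proof -
  obtain S T where S: "\<forall>f\<in>S. \<exists>n. homogeneous n f" "A = zero_locus S"
    and T: "\<forall>f\<in>T. \<exists>n. homogeneous n f" "B = zero_locus T"
    using assms by (auto simp: zariski_closed_def)
  have "A \<union> B = zero_locus {f * g | f g. f \<in> S \<and> g \<in> T}"
    unfolding S T zero_locus_def vanishes_at_def by fastforce
  moreover have "\<forall>f\<in>{f * g | f g. f \<in> S \<and> g \<in> T}. \<exists>n. homogeneous n f"
    using S(1) T(1) homogeneous_mult by blast
  ultimately show ?thesis
    unfolding zariski_closed_def by blast
qed

lemma zariski_closed_empty: "zariski_closed {}"
  unfolding zariski_closed_def zero_locus_def vanishes_at_def
  by (rule exI[of _ "{1}"]) (use homogeneous_1 in auto)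

lemma zariski_closed_finite: "finite S \<Longrightarrow> zariski_closed S"
proof (induction rule: finite_induct)
  case (insert a S)
  then show ?case
    using zariski_closed_Un[OF zariski_closed_singleton] by fastforce
qed (rule zariski_closed_empty)

text \<open>Finite sets are closed, so a finite variety would split into one point and the remaining
  points; irreducibility leaves only the point.\<close>

lemma projective_variety_infinite:
  assumes "projective_variety V" "\<not> is_singleton V"
  shows "infinite V"
proof
  assume "finite V"
  obtain P where P: "P \<in> V"
    using assms(1) by (auto simp: projective_variety_def)
  have "V \<subseteq> {P} \<union> (V - {P})"
    by blast
  then have "V \<subseteq> {P} \<or> V \<subseteq> V - {P}"
    using assms(1) zariski_closed_singleton zariski_closed_finite \<open>finite V\<close>
    unfolding projective_variety_def by (meson finite_Diff)
  then have "V = {P}"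
    using P by blast
  with assms(2) show False
    by (simp add: is_singleton_def)
qed

lemma zariski_closed_hypersurface: "homogeneous n f \<Longrightarrow> zariski_closed (zero_locus {f})"
  unfolding zariski_closed_def by (intro exI[of _ "{f}"]) auto


section \<open>Composition of morphisms and images of birational morphisms\<close>

text \<open>Evaluating the substitution at \<open>P\<close> evaluates \<open>F\<close> at the vector
  of values of \<open>H\<close>. That vector is nonzero, hence it is a set of coordinates of
  \<open>tuple_value H P\<close>.\<close>

lemma nonzero_at_subst:
  fixes F :: "'m::finite \<Rightarrow> ('l::finite, 'a::field) mpoly"
  assumes "homogeneous_tuple F" "nonzero_at H P"
  shows "nonzero_at (\<lambda>i. mpoly_subst (F i) H) P \<longleftrightarrow> nonzero_at F (tuple_value H P)"
proof -
  let ?w = "\<chi> i. mpoly_eval (H i) (rep_proj P)"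
  have "?w \<noteq> 0"
    using assms(2) by (auto simp: nonzero_at_def vanishes_at_def vec_eq_iff)
  then show ?thesis
    using nonzero_at_abs_proj[OF assms(1)]
    by (simp add: tuple_value_def nonzero_at_def vanishes_at_def vec_eq_iff)
qed

lemma represents_on_compose:
  assumes H: "represents_on U H f" and F: "represents_on V F g" and "f ` U \<subseteq> V"
  shows "represents_on U (\<lambda>i. mpoly_subst (F i) H) (g \<circ> f)"
  unfolding represents_on_def
proof (intro conjI ballI impI)
  from H F show "homogeneous_tuple (\<lambda>i. mpoly_subst (F i) H)"
    unfolding represents_on_def homogeneous_tuple_def by (meson homogeneous_subst)
next
  fix P assume P: "P \<in> U" and nz: "nonzero_at (\<lambda>i. mpoly_subst (F i) H) P"
  let ?w = "\<chi> i. mpoly_eval (H i) (rep_proj P)"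
  have val: "tuple_value (\<lambda>i. mpoly_subst (F i) H) P = abs_proj (\<chi> i. mpoly_eval (F i) ?w)"
    by (simp add: tuple_value_def)
  have F': "homogeneous_tuple F"
    using F by (simp add: represents_on_def)
  show "(g \<circ> f) P = tuple_value (\<lambda>i. mpoly_subst (F i) H) P"
  proof (cases "nonzero_at H P")
    case True
    have w: "?w \<noteq> 0"
      using True by (auto simp: nonzero_at_def vanishes_at_def vec_eq_iff)
    have "f P = tuple_value H P"
      using H P True by (simp add: represents_on_def)
    moreover have "nonzero_at F (tuple_value H P)"
      using nonzero_at_subst[OF F' True] nz by simp
    moreover have "f P \<in> V"
      using assms(3) P by blast
    ultimately have "(g \<circ> f) P = tuple_value F (abs_proj ?w)" "nonzero_at F (abs_proj ?w)"
      using F by (auto simp: represents_on_def tuple_value_def)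
    then show ?thesis
      by (simp add: val tuple_value_abs_proj[OF F' w])
  next
    case False
    \<comment> \<open>Where \<open>H\<close> vanishes but the composition does not, \<open>F\<close> is a tuple of constants.\<close>
    obtain n where n: "\<And>i. homogeneous n (F i)"
      using F' by (auto simp: homogeneous_tuple_def)
    \<comment> \<open>The zero vector is written as zero times an arbitrary \<open>v\<close>, so
      that the scaling formula compares the value of \<open>F i\<close> at the origin with its value
      at every \<open>v\<close>.\<close>
    have w: "?w = 0 *s v" for v
      using False by (auto simp: nonzero_at_def vanishes_at_def vec_eq_iff)
    have ev: "mpoly_eval (F i) ?w = 0 ^ n * mpoly_eval (F i) v" for i v
      unfolding w[of v] by (rule homogeneous_eval_scale[OF n])
    have nz': "\<exists>i. mpoly_eval (F i) ?w \<noteq> 0"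
      using nz by (simp add: nonzero_at_def vanishes_at_def)
    then have "n = 0"
      using ev by (metis mult_zero_left power_0_left)
    have const: "mpoly_eval (F i) v = mpoly_eval (F i) ?w" for i v
      using ev[of i v] unfolding \<open>n = 0\<close> by simp
    have "nonzero_at F (f P)"
      using nz' const[of _ "rep_proj (f P)"] by (auto simp: nonzero_at_def vanishes_at_def)
    moreover have "f P \<in> V"
      using assms(3) P by blast
    ultimately have "(g \<circ> f) P = tuple_value F (f P)"
      using F by (simp add: represents_on_def)
    also have "\<dots> = abs_proj (\<chi> i. mpoly_eval (F i) ?w)"
      unfolding tuple_value_def using const[of _ "rep_proj (f P)"] by simp
    finally show ?thesis
      by (simp add: val)
  qed
qed

text \<open>The assumption on \<open>g\<close> provides a tuple over the base field at every point
  of \<open>V\<close>. A single tuple that is nonzero somewhere on \<open>V\<close> might vanish on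
  the whole image of \<open>f\<close>, and its composition with \<open>f\<close> would then
  represent nothing.\<close>

lemma morphism_over_base_compose:
  assumes f: "morphism_over_base U V f" and "g ` V \<subseteq> W"
    and g: "\<And>Q. Q \<in> V \<Longrightarrow> \<exists>F. (\<forall>i. over_base (F i)) \<and> represents_on V F g \<and> nonzero_at F Q"
  shows "morphism_over_base U W (g \<circ> f)"
proof -
  have fUV: "f ` U \<subseteq> V"
    using f by (simp add: morphism_over_base_def morphism_on_def)
  have comp: "\<exists>F. (\<forall>i. over_base (F i)) \<and> represents_on U (\<lambda>i. mpoly_subst (F i) H) (g \<circ> f) \<and>
      nonzero_at (\<lambda>i. mpoly_subst (F i) H) P"
    if "P \<in> U" "represents_on U H f" "nonzero_at H P" for P H
  proof -
    have "f P \<in> V"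
      using fUV that(1) by blast
    from g[OF this] obtain F
      where F: "\<forall>i. over_base (F i)" "represents_on V F g" "nonzero_at F (f P)"
      by blast
    have "homogeneous_tuple F" and fP: "f P = tuple_value H P"
      using F(2) that by (simp_all add: represents_on_def)
    from nonzero_at_subst[OF this(1) that(3)] F(3)
    have "nonzero_at (\<lambda>i. mpoly_subst (F i) H) P"
      unfolding fP by blast
    with F(1) represents_on_compose[OF that(2) F(2) fUV] show ?thesis
      by (intro exI[of _ F]) simp
  qed
  \<comment> \<open>The local tuples of \<open>morphism_on\<close> may have arbitrary coefficients,
    so the composite over the base field starts from the tuple over the base field that comes with
    \<open>f\<close>.\<close>
  obtain H P where H: "\<forall>i. over_base (H i)" "represents_on U H f" "P \<in> U" "nonzero_at H P"
    using f by (auto simp: morphism_over_base_def)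
  from comp[OF H(3,2,4)] obtain F where F: "\<forall>i. over_base (F i)"
      "represents_on U (\<lambda>i. mpoly_subst (F i) H) (g \<circ> f)"
      "nonzero_at (\<lambda>i. mpoly_subst (F i) H) P"
    by blast
  have "morphism_on U W (g \<circ> f)"
    unfolding morphism_on_def
  proof (intro conjI ballI)
    show "(g \<circ> f) ` U \<subseteq> W"
      using fUV \<open>g ` V \<subseteq> W\<close> by auto
  next
    fix P assume "P \<in> U"
    then obtain H where "represents_on U H f" "nonzero_at H P"
      using f unfolding morphism_over_base_def morphism_on_def by blast
    from comp[OF \<open>P \<in> U\<close> this]
    show "\<exists>F. represents_on U F (g \<circ> f) \<and> nonzero_at F P"
      by blast
  qed
  moreover have "\<forall>i. over_base (mpoly_subst (F i) H)"
    using F(1) H(1) by (simp add: over_base_subst)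
  ultimately show ?thesis
    using F(2,3) H(3) unfolding morphism_over_base_def
    by (intro conjI exI[of _ "\<lambda>i. mpoly_subst (F i) H"] bexI[of _ P])
qed

text \<open>On a nonempty open part of \<open>V\<close> the inverse \<open>G\<close> recovers a
  point from its image. If the image were finite, this open part would be finite, and irreducibility
  would make \<open>V\<close> finite.\<close>

lemma birational_morphism_image_infinite:
  assumes V: "projective_variety V" "\<not> is_singleton V"
    and \<pi>: "birational_morphism_over_base V W \<pi>"
  shows "infinite (\<pi> ` V)"
proof
  assume fin: "finite (\<pi> ` V)"
  obtain G Q where G: "homogeneous_tuple G" and Q: "Q \<in> W" "nonzero_at G Q"
    and GW: "\<And>Q. Q \<in> W \<Longrightarrow> nonzero_at G Q \<Longrightarrow> tuple_value G Q \<in> V \<and> \<pi> (tuple_value G Q) = Q"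
    and GV: "\<And>P. P \<in> V \<Longrightarrow> nonzero_at G (\<pi> P) \<Longrightarrow> tuple_value G (\<pi> P) = P"
    using \<pi> unfolding birational_morphism_over_base_def by blast
  \<comment> \<open>\<open>R\<close> witnesses that the open part is nonempty: \<open>G\<close> is
    nonzero at its image \<open>Q\<close>.\<close>
  define R where "R = tuple_value G Q"
  have R: "R \<in> V" "\<pi> R = Q"
    using GW[OF Q] by (auto simp: R_def)
  obtain H where H: "represents_on V H \<pi>" "nonzero_at H R"
    using \<pi> R unfolding birational_morphism_over_base_def morphism_over_base_def morphism_on_def
    by blast
  then have "nonzero_at (\<lambda>i. mpoly_subst (G i) H) R"
    using nonzero_at_subst[OF G H(2)] R Q by (auto simp: represents_on_def)
  then obtain i j where ij: "\<not> vanishes_at (mpoly_subst (G i) H) R" "\<not> vanishes_at (H j) R"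
    using H(2) by (auto simp: nonzero_at_def)
  \<comment> \<open>Outside the zero locus of this product \<open>H\<close> computes
    \<open>\<pi>\<close> and \<open>G\<close> is nonzero at the image. A single form describes both
    conditions, so irreducibility applies to one hypersurface.\<close>
  define g where "g = mpoly_subst (G i) H * H j"
  have "\<exists>n. homogeneous n g"
    using G H(1) unfolding represents_on_def homogeneous_tuple_def g_def
    by (meson homogeneous_mult homogeneous_subst)
  then have Z: "zariski_closed (zero_locus {g})"
    using zariski_closed_hypersurface by blast
  let ?T = "tuple_value G ` \<pi> ` V"
  have "P \<in> ?T" if P: "P \<in> V" "P \<notin> zero_locus {g}" for P
  proof -
    have nz: "nonzero_at (\<lambda>i. mpoly_subst (G i) H) P" "nonzero_at H P"
      using P(2) by (auto simp: g_def zero_locus_def nonzero_at_def vanishes_at_def)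
    then have "nonzero_at G (\<pi> P)"
      using nonzero_at_subst[OF G nz(2)] H(1) P(1) by (simp add: represents_on_def)
    then show ?thesis
      using GV[OF P(1)] P(1) by (metis imageI)
  qed
  \<comment> \<open>Irreducibility chooses between a hypersurface missing \<open>R\<close> and a
    finite set.\<close>
  then have "V \<subseteq> zero_locus {g} \<union> ?T"
    by blast
  moreover have "zariski_closed ?T"
    using fin by (intro zariski_closed_finite) simp
  ultimately have "V \<subseteq> zero_locus {g} \<or> V \<subseteq> ?T"
    using V(1) Z unfolding projective_variety_def by blast
  moreover have "R \<notin> zero_locus {g}"
    using ij by (simp add: g_def zero_locus_def vanishes_at_def)
  ultimately have "V \<subseteq> ?T"
    using R(1) by blast
  then have "finite V"
    using fin by (meson finite_imageI finite_subset)
  with projective_variety_infinite[OF V] show False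
    by simp
qed


section \<open>The morphism from the plane Edwards curve to the Legendre curve\<close>

definition edwards_poly :: "'k::field \<Rightarrow> (3, 'k alg_closure) mpoly" where
  "edwards_poly d = mvar 3 ^ 2 * (mvar 1 ^ 2 + mvar 2 ^ 2 - mvar 3 ^ 2)
     - mconst (to_ac d) * (mvar 1 ^ 2 * mvar 2 ^ 2)"

definition legendre_map :: "'k::field \<Rightarrow> 3 \<Rightarrow> (3, 'k alg_closure) mpoly" where
  "legendre_map d i = (vector
     [mvar 1 * mvar 3 ^ 2,
      mvar 2 * (mvar 3 ^ 2 - mconst (to_ac d) * mvar 1 ^ 2),
      mvar 1 ^ 3] :: (3, 'k alg_closure) mpoly ^ 3) $ i"

text \<open>This is \<open>legendre_map\<close> times D^2 / x^3. The denominators disappear by z^2 D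
  = d x^2 y^2 and D (y^2 - D) = D (z^2 - x^2) = x^2 (d y^2 - D).\<close>

definition legendre_map' :: "'k::field \<Rightarrow> 3 \<Rightarrow> (3, 'k alg_closure) mpoly" where
  "legendre_map' d i = (let D = mvar 1 ^ 2 + mvar 2 ^ 2 - mvar 3 ^ 2; c = mconst (to_ac d) in
     vector
     [c * (mvar 2 ^ 2 * D),
      c * (mvar 1 * mvar 2 * (c * mvar 2 ^ 2 - D)),
      D ^ 2] :: (3, 'k alg_closure) mpoly ^ 3) $ i"

definition edwards_to_legendre ::
    "'k::field \<Rightarrow> ('k alg_closure, 3) proj \<Rightarrow> ('k alg_closure, 3) proj" where
  "edwards_to_legendre d P = (if nonzero_at (legendre_map d) P
     then tuple_value (legendre_map d) P else tuple_value (legendre_map' d) P)"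

text \<open>Degrees of factors stay schematic while these rules are applied; constants and variables
  fix them, and \<open>refl\<close> or \<open>simp\<close> closes the remaining equations between
  degrees.\<close>

lemmas homogeneous_intros =
  homogeneous_add homogeneous_diff homogeneous_mult homogeneous_power homogeneous_mconst
  homogeneous_mvar

lemmas over_base_intros =
  over_base_add over_base_diff over_base_mult over_base_power over_base_mvar
  over_base_single[OF rangeI]

lemma homogeneous_edwards_poly: "homogeneous 4 (edwards_poly d)"
  unfolding edwards_poly_def by (rule homogeneous_intros refl | (simp; fail))+

lemma homogeneous_tuple_legendre_map: "homogeneous_tuple (legendre_map d)"
proof -
  have "homogeneous 3 (legendre_map d i)" for i
    using exhaust_3[of i]
    by (elim disjE; simp add: legendre_map_def del: One_nat_def)
      (rule homogeneous_intros refl | (simp; fail))+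
  then show ?thesis
    unfolding homogeneous_tuple_def by blast
qed

lemma homogeneous_tuple_legendre_map': "homogeneous_tuple (legendre_map' d)"
proof -
  have "homogeneous 4 (legendre_map' d i)" for i
    using exhaust_3[of i]
    by (elim disjE; simp add: legendre_map'_def Let_def)
      (rule homogeneous_intros refl | (simp; fail))+
  then show ?thesis
    unfolding homogeneous_tuple_def by blast
qed

lemma over_base_legendre_map: "over_base (legendre_map d i)"
  using exhaust_3[of i] by (auto simp: legendre_map_def intro!: over_base_intros)

lemma over_base_legendre_map': "over_base (legendre_map' d i)"
  using exhaust_3[of i] by (auto simp: legendre_map'_def Let_def intro!: over_base_intros)

lemma vector_3_eta: "v = vector [v $ 1, v $ 2, v $ 3]"
  for v :: "'a::zero ^ 3"
  by (simp add: vec_eq_iff forall_3)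

lemma vector_3_eq_0: "vector [x, y, z] = (0 :: 'a::zero ^ 3) \<longleftrightarrow> x = 0 \<and> y = 0 \<and> z = 0"
  by (simp add: vec_eq_iff forall_3)

text \<open>The closure lies in every closed set that contains the affine points, in particular in
  the quartic \<open>edwards_poly\<close>, the homogenized affine equation.\<close>

lemma edwards_projective_coords:
  assumes "P \<in> edwards_projective d"
  obtains x y z where "P = abs_proj (vector [x, y, z])" "(x, y, z) \<noteq> (0, 0, 0)"
    "z\<^sup>2 * (x\<^sup>2 + y\<^sup>2 - z\<^sup>2) = to_ac d * x\<^sup>2 * y\<^sup>2"
proof -
  have "P \<in> zero_locus {edwards_poly d}"
  proof -
    have "abs_proj (vector [x, y, 1]) \<in> zero_locus {edwards_poly d}"
      if "(x, y) \<in> edwards_affine d" for x y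
    proof -
      have "vector [x, y, 1] \<noteq> (0 :: 'a alg_closure ^ 3)"
        by (simp add: vector_3_eq_0)
      then show ?thesis
        using that vanishes_at_abs_proj[OF homogeneous_edwards_poly, of _ d]
        by (simp add: zero_locus_def edwards_affine_def edwards_poly_def)
    qed
    then have "(\<lambda>(x, y). abs_proj (vector [x, y, 1])) ` edwards_affine d
        \<subseteq> zero_locus {edwards_poly d}"
      by auto
    moreover have "zariski_closed (zero_locus {edwards_poly d})"
      using zariski_closed_hypersurface homogeneous_edwards_poly by blast
    ultimately show ?thesis
      using assms unfolding edwards_projective_def zariski_closure_def by blast
  qed
  then have "mpoly_eval (edwards_poly d) (rep_proj P) = 0"
    by (simp add: zero_locus_def vanishes_at_def)
  then show ?thesis
    using that[of "rep_proj P $ 1" "rep_proj P $ 2" "rep_proj P $ 3"] rep_proj_nonzero[of P]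
    unfolding vector_3_eta[symmetric] abs_rep_proj
    by (simp add: edwards_poly_def vec_eq_iff forall_3 algebra_simps)
qed

section \<open>The two triples on the plane model\<close>

lemma legendre_map_eval:
  "(\<chi> i. mpoly_eval (legendre_map d i) (vector [x, y, z])) =
     vector [x * z\<^sup>2, y * (z\<^sup>2 - to_ac d * x\<^sup>2), x ^ 3]"
  by (simp add: vec_eq_iff forall_3 legendre_map_def)

lemma legendre_map'_eval:
  "(\<chi> i. mpoly_eval (legendre_map' d i) (vector [x, y, z])) =
     (let D = x\<^sup>2 + y\<^sup>2 - z\<^sup>2; c = to_ac d in
      vector [c * (y\<^sup>2 * D), c * (x * y * (c * y\<^sup>2 - D)), D\<^sup>2])"
  by (simp add: vec_eq_iff forall_3 legendre_map'_def Let_def)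

text \<open>On the quartic \<open>legendre_map\<close> vanishes only at (0 : 1 : 0). There D = y^2,
  and \<open>legendre_map'\<close> takes the value (d : 0 : 1).\<close>

lemma legendre_map_nonzero:
  assumes "P \<in> edwards_projective d"
  shows "nonzero_at (legendre_map d) P \<or> nonzero_at (legendre_map' d) P"
proof -
  obtain x y z where P: "P = abs_proj (vector [x, y, z])" "(x, y, z) \<noteq> (0, 0, 0)"
    "z\<^sup>2 * (x\<^sup>2 + y\<^sup>2 - z\<^sup>2) = to_ac d * x\<^sup>2 * y\<^sup>2"
    using edwards_projective_coords[OF assms] .
  have v: "vector [x, y, z] \<noteq> (0 :: 'a alg_closure ^ 3)"
    using P(2) by (auto simp: vector_3_eq_0)
  show ?thesis
    unfolding P(1) nonzero_at_abs_proj[OF homogeneous_tuple_legendre_map v]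
      nonzero_at_abs_proj[OF homogeneous_tuple_legendre_map' v]
      legendre_map_eval legendre_map'_eval Let_def
    using P(2,3) by (auto simp: vector_3_eq_0)
qed

text \<open>Memberships in the ideal of the curve. The first three are the 2 x 2 minors of the two
  triples, the last two the Legendre equation for each triple. Nothing is divided by, so they hold
  at every point of the quartic.\<close>

lemma legendre_identities:
  fixes x y z c D :: "'a::field"
  assumes "D = x\<^sup>2 + y\<^sup>2 - z\<^sup>2" "z\<^sup>2 * D = c * x\<^sup>2 * y\<^sup>2"
  shows "x * z\<^sup>2 * (c * (x * y * (c * y\<^sup>2 - D))) = y * (z\<^sup>2 - c * x\<^sup>2) * (c * (y\<^sup>2 * D))"
    and "x * z\<^sup>2 * D\<^sup>2 = x ^ 3 * (c * (y\<^sup>2 * D))"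
    and "y * (z\<^sup>2 - c * x\<^sup>2) * D\<^sup>2 = x ^ 3 * (c * (x * y * (c * y\<^sup>2 - D)))"
    and "(y * (z\<^sup>2 - c * x\<^sup>2))\<^sup>2 * x ^ 3 =
      x * z\<^sup>2 * (x * z\<^sup>2 - x ^ 3) * (x * z\<^sup>2 - c * x ^ 3)"
    and "(c * (x * y * (c * y\<^sup>2 - D)))\<^sup>2 * D\<^sup>2 =
      c * (y\<^sup>2 * D) * (c * (y\<^sup>2 * D) - D\<^sup>2) * (c * (y\<^sup>2 * D) - c * D\<^sup>2)"
  using assms by Groebner_Basis.algebra+

lemma legendre_maps_agree:
  assumes "P \<in> edwards_projective d" "nonzero_at (legendre_map d) P" "nonzero_at (legendre_map' d) P"
  shows "tuple_value (legendre_map d) P = tuple_value (legendre_map' d) P"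
proof -
  obtain x y z where P: "P = abs_proj (vector [x, y, z])" "(x, y, z) \<noteq> (0, 0, 0)"
    and e: "z\<^sup>2 * (x\<^sup>2 + y\<^sup>2 - z\<^sup>2) = to_ac d * x\<^sup>2 * y\<^sup>2"
    using edwards_projective_coords[OF assms(1)] .
  have v: "vector [x, y, z] \<noteq> (0 :: 'a alg_closure ^ 3)"
    using P(2) by (auto simp: vector_3_eq_0)
  define D where "D = x\<^sup>2 + y\<^sup>2 - z\<^sup>2"
  define c where "c = to_ac d"
  let ?w = "vector [x * z\<^sup>2, y * (z\<^sup>2 - c * x\<^sup>2), x ^ 3] :: 'a alg_closure ^ 3"
  let ?w' = "vector [c * (y\<^sup>2 * D), c * (x * y * (c * y\<^sup>2 - D)), D\<^sup>2] :: 'a alg_closure ^ 3"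
  note ev = legendre_map_eval[of d x y z, folded c_def]
    legendre_map'_eval[of d x y z, unfolded Let_def, folded D_def c_def]
  note hom = homogeneous_tuple_legendre_map[of d] homogeneous_tuple_legendre_map'[of d]
  have nz: "?w \<noteq> 0" "?w' \<noteq> 0"
    using assms(2,3) unfolding P(1) nonzero_at_abs_proj[OF hom(1) v]
      nonzero_at_abs_proj[OF hom(2) v] ev by blast+
  have e': "z\<^sup>2 * D = c * x\<^sup>2 * y\<^sup>2"
    using e by (simp add: D_def c_def)
  have "\<forall>i j. ?w $ i * ?w' $ j = ?w $ j * ?w' $ i"
    unfolding forall_3 vector_3 using legendre_identities(1-3)[OF D_def e'] by metis
  then have "abs_proj ?w = abs_proj ?w'"
    using abs_proj_eqI[OF nz] by blast
  then show ?thesis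
    using assms(2,3) tuple_value_abs_proj[OF hom(1) v] tuple_value_abs_proj[OF hom(2) v]
    unfolding P(1) ev by simp
qed

lemma edwards_to_legendre_image:
  "edwards_to_legendre d ` edwards_projective d \<subseteq> fst (legendre_curve d)"
proof
  fix R assume "R \<in> edwards_to_legendre d ` edwards_projective d"
  then obtain P where PE: "P \<in> edwards_projective d" and R: "R = edwards_to_legendre d P"
    by blast
  obtain x y z where P: "P = abs_proj (vector [x, y, z])" "(x, y, z) \<noteq> (0, 0, 0)"
    and e: "z\<^sup>2 * (x\<^sup>2 + y\<^sup>2 - z\<^sup>2) = to_ac d * x\<^sup>2 * y\<^sup>2"
    using edwards_projective_coords[OF PE] .
  have v: "vector [x, y, z] \<noteq> (0 :: 'a alg_closure ^ 3)"
    using P(2) by (auto simp: vector_3_eq_0)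
  define D where "D = x\<^sup>2 + y\<^sup>2 - z\<^sup>2"
  define c where "c = to_ac d"
  note ev = legendre_map_eval[of d x y z, folded c_def]
    legendre_map'_eval[of d x y z, unfolded Let_def, folded D_def c_def]
  note hom = homogeneous_tuple_legendre_map[of d] homogeneous_tuple_legendre_map'[of d]
  have e': "z\<^sup>2 * D = c * x\<^sup>2 * y\<^sup>2"
    using e by (simp add: D_def c_def)
  have mem: "abs_proj (vector [r, s, t]) \<in> fst (legendre_curve d)"
    if "vector [r, s, t] \<noteq> (0 :: 'a alg_closure ^ 3)" "s\<^sup>2 * t = r * (r - t) * (r - c * t)" for r s t
    using that unfolding legendre_curve_def c_def by (fastforce simp: vector_3_eq_0)
  show "R \<in> fst (legendre_curve d)"
  proof (cases "nonzero_at (legendre_map d) P")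
    case True
    from legendre_identities(4)[OF D_def e'] True mem show ?thesis
      unfolding R edwards_to_legendre_def P(1)
      by (simp add: tuple_value_abs_proj[OF hom(1) v] nonzero_at_abs_proj[OF hom(1) v] ev)
  next
    case False
    then have nz: "nonzero_at (legendre_map' d) P"
      using legendre_map_nonzero[OF PE] by blast
    have "abs_proj (vector [c * (y\<^sup>2 * D), c * (x * y * (c * y\<^sup>2 - D)), D\<^sup>2])
        \<in> fst (legendre_curve d)"
      using nz legendre_identities(5)[OF D_def e'] unfolding P(1) nonzero_at_abs_proj[OF hom(2) v] ev by (intro mem)
    then show ?thesis
      using False nz unfolding R edwards_to_legendre_def P(1)
      by (simp add: tuple_value_abs_proj[OF hom(2) v] ev)
  qed
qed

text \<open>At infinity the third entry vanishes, so x^3 = 0. The curve equation becomes z^2 (y^2 -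
  z^2) = 0, and the nonvanishing of the first triple excludes z = 0.\<close>

lemma edwards_to_legendre_eq_infinity:
  assumes PE: "P \<in> edwards_projective d"
    and inf: "edwards_to_legendre d P = abs_proj (vector [0, 1, 0])"
  shows "P \<in> {abs_proj (vector [0, 1, 1]), abs_proj (vector [0, -1, 1])}"
proof -
  obtain x y z where P: "P = abs_proj (vector [x, y, z])" "(x, y, z) \<noteq> (0, 0, 0)"
    and e: "z\<^sup>2 * (x\<^sup>2 + y\<^sup>2 - z\<^sup>2) = to_ac d * x\<^sup>2 * y\<^sup>2"
    using edwards_projective_coords[OF PE] .
  have v: "vector [x, y, z] \<noteq> (0 :: 'a alg_closure ^ 3)"
    using P(2) by (auto simp: vector_3_eq_0)
  note hom = homogeneous_tuple_legendre_map[of d] homogeneous_tuple_legendre_map'[of d]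
  have u: "vector [0, 1, 0] \<noteq> (0 :: 'a alg_closure ^ 3)"
    by (simp add: vector_3_eq_0)
  have inf_coords: "r = 0 \<and> t = 0"
    if eq: "abs_proj (vector [r, s, t]) = abs_proj (vector [0, 1, 0] :: 'a alg_closure ^ 3)"
      and w: "vector [r, s, t] \<noteq> (0 :: 'a alg_closure ^ 3)" for r s t :: "'a alg_closure"
  proof -
    from iffD1[OF abs_proj_eq_iff[OF w u] eq] obtain a where "a \<noteq> 0"
      and a: "vector [0, 1, 0] = a *s (vector [r, s, t] :: 'a alg_closure ^ 3)"
      by (elim exE conjE) (rule that)
    have "(vector [0, 1, 0] :: 'a alg_closure ^ 3) $ i = a * vector [r, s, t] $ i" for i
      unfolding a by simp
    from this[of 1] this[of 3] \<open>a \<noteq> 0\<close> show ?thesis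
      by simp
  qed
  have "nonzero_at (legendre_map d) P"
  \<comment> \<open>If the second triple were in use, then x = 0, and D = 0 because the value is at
    infinity; these two make all of its entries zero.\<close>
  proof (rule ccontr)
    assume z: "\<not> nonzero_at (legendre_map d) P"
    then have nz: "nonzero_at (legendre_map' d) P"
      using legendre_map_nonzero[OF PE] by blast
    from nz nonzero_at_abs_proj[OF hom(2) v]
    have w: "vector [to_ac d * (y\<^sup>2 * (x\<^sup>2 + y\<^sup>2 - z\<^sup>2)),
          to_ac d * (x * y * (to_ac d * y\<^sup>2 - (x\<^sup>2 + y\<^sup>2 - z\<^sup>2))),
          (x\<^sup>2 + y\<^sup>2 - z\<^sup>2)\<^sup>2] \<noteq> (0 :: 'a alg_closure ^ 3)"
      unfolding P(1) legendre_map'_eval Let_def by blast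
    have "x = 0"
      using z unfolding P(1) nonzero_at_abs_proj[OF hom(1) v] legendre_map_eval
      by (simp add: vector_3_eq_0)
    moreover have "(x\<^sup>2 + y\<^sup>2 - z\<^sup>2)\<^sup>2 = 0"
      using inf z nz inf_coords[OF _ w] unfolding edwards_to_legendre_def P(1)
      by (simp add: tuple_value_abs_proj[OF hom(2) v] legendre_map'_eval Let_def)
    ultimately show False
      using w by (simp add: vector_3_eq_0)
  qed
  then have w: "vector [x * z\<^sup>2, y * (z\<^sup>2 - to_ac d * x\<^sup>2), x ^ 3] \<noteq> (0 :: 'a alg_closure ^ 3)"
    and "abs_proj (vector [x * z\<^sup>2, y * (z\<^sup>2 - to_ac d * x\<^sup>2), x ^ 3]) =
      abs_proj (vector [0, 1, 0] :: 'a alg_closure ^ 3)"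
    using inf unfolding edwards_to_legendre_def P(1)
    by (simp_all add: tuple_value_abs_proj[OF hom(1) v] nonzero_at_abs_proj[OF hom(1) v]
        legendre_map_eval)
  from inf_coords[OF this(2,1)] have "x ^ 3 = 0"
    by blast
  then have x: "x = 0"
    by simp
  \<comment> \<open>With x = 0 the triple is (0, y z^2, 0), which is nonzero.\<close>
  have z: "z \<noteq> 0"
    using \<open>nonzero_at (legendre_map d) P\<close> unfolding P(1) nonzero_at_abs_proj[OF hom(1) v]
      legendre_map_eval by (auto simp: vector_3_eq_0 x)
  have "(y - z) * (y + z) = 0"
    using e x z by (simp add: power2_eq_square algebra_simps)
  then have "y = z \<or> y = - z"
    by (auto simp: eq_neg_iff_add_eq_0)
  \<comment> \<open>The parameter \<open>a\<close> stands for both signs in y = z and y =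
    -z.\<close>
  moreover have "abs_proj (vector [0, a * z, z]) = abs_proj (vector [0, a, 1] :: 'a alg_closure ^ 3)"
    for a
  proof (rule abs_proj_eqI)
    let ?u = "vector [0, a * z, z] :: 'a alg_closure ^ 3"
    let ?u' = "vector [0, a, 1] :: 'a alg_closure ^ 3"
    show "?u \<noteq> 0" "?u' \<noteq> 0"
      using z by (simp_all add: vector_3_eq_0)
    have "\<forall>i j. ?u $ i * ?u' $ j = ?u $ j * ?u' $ i"
      unfolding forall_3 vector_3 by simp
    then show "?u $ i * ?u' $ j = ?u $ j * ?u' $ i" for i j
      by blast
  qed
  from this[of 1] this[of "-1"] calculation show ?thesis
    unfolding P(1) x by auto
qed

text \<open>Both triples represent the map on the whole plane curve because they agree wherever both
  are nonzero, and at each point at least one of them is nonzero.\<close>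

lemma edwards_to_legendre_represented:
  assumes "P \<in> edwards_projective d"
  shows "\<exists>F. (\<forall>i. over_base (F i)) \<and>
    represents_on (edwards_projective d) F (edwards_to_legendre d) \<and> nonzero_at F P"
proof -
  have "represents_on (edwards_projective d) (legendre_map d) (edwards_to_legendre d)"
    "represents_on (edwards_projective d) (legendre_map' d) (edwards_to_legendre d)"
    using legendre_maps_agree
    by (auto simp: represents_on_def edwards_to_legendre_def homogeneous_tuple_legendre_map
        homogeneous_tuple_legendre_map')
  then show ?thesis
    using legendre_map_nonzero[OF assms] over_base_legendre_map over_base_legendre_map' by blast
qed

lemma edwards_to_legendre_base_point:
  "edwards_to_legendre d (abs_proj (vector [0, 1, 1])) = abs_proj (vector [0, 1, 0])"
proof -
  have "vector [0, 1, 1] \<noteq> (0 :: 'a alg_closure ^ 3)"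
    by (simp add: vector_3_eq_0)
  from nonzero_at_abs_proj[OF homogeneous_tuple_legendre_map this]
    tuple_value_abs_proj[OF homogeneous_tuple_legendre_map this]
  show ?thesis
    by (simp add: edwards_to_legendre_def legendre_map_eval vector_3_eq_0)
qed

theorem theorem2p2:
  fixes q :: nat and d :: "'k::{field,finite}"
    and E :: "('k alg_closure, 'n::finite) proj set \<times> ('k alg_closure, 'n) proj"
  assumes "CARD('k) = q" and "odd q"
    and "d \<noteq> 0" and "d \<noteq> 1"
    and "is_edwards_curve d E"
  shows "isogenous_over_base E (legendre_curve d)"
proof -
  let ?W = "edwards_projective d" and ?g = "edwards_to_legendre d"
  obtain \<pi> where E: "projective_variety (fst E)" "\<not> is_singleton (fst E)" "snd E \<in> fst E"
    and \<pi>: "birational_morphism_over_base (fst E) ?W \<pi>" "\<pi> (snd E) = abs_proj (vector [0, 1, 1])"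
    using assms(5) unfolding is_edwards_curve_def desingularization_def
      nonsingular_projective_curve_def projective_curve_def by blast
  have mor: "morphism_over_base (fst E) ?W \<pi>"
    using \<pi>(1) by (simp add: birational_morphism_over_base_def)
  have "morphism_over_base (fst E) (fst (legendre_curve d)) (?g \<circ> \<pi>)"
    using mor edwards_to_legendre_image edwards_to_legendre_represented
    by (rule morphism_over_base_compose)
  moreover have base: "(?g \<circ> \<pi>) (snd E) = abs_proj (vector [0, 1, 0])"
    by (simp add: \<pi>(2) edwards_to_legendre_base_point)
  \<comment> \<open>A constant value would have to be the image of the base point, the point at
    infinity. The image of \<open>\<pi>\<close> would then lie in a fibre of at most two points,
    although it is infinite.\<close>
  moreover have "\<nexists>Q. \<forall>P\<in>fst E. (?g \<circ> \<pi>) P = Q"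
  proof
    assume "\<exists>Q. \<forall>P\<in>fst E. (?g \<circ> \<pi>) P = Q"
    then have const: "\<And>P. P \<in> fst E \<Longrightarrow> ?g (\<pi> P) = abs_proj (vector [0, 1, 0])"
      using base E(3) by (metis comp_apply)
    have "\<pi> ` fst E \<subseteq> ?W"
      using mor by (simp add: morphism_over_base_def morphism_on_def)
    with const have "\<pi> ` fst E \<subseteq> {abs_proj (vector [0, 1, 1]), abs_proj (vector [0, -1, 1])}"
      using edwards_to_legendre_eq_infinity by blast
    then have "finite (\<pi> ` fst E)"
      using finite_subset by blast
    with birational_morphism_image_infinite[OF E(1,2) \<pi>(1)] show False ..
  qed
  ultimately show ?thesis
    unfolding isogenous_over_base_def isogeny_over_base_def
    by (intro exI[of _ "?g \<circ> \<pi>"]) (simp add: legendre_curve_def)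
qed

end
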